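(* Let $n \geq 1$ be an integer, let $k>0$ be a real number, let $\xi \in [0,\pi]$, and set $b_s := \cos\left(\frac{\xi+2\pi s}{n}\right)$ for $s=1,\ldots,n$. Then, for any integer $N \geq 0$, $$\sum_{\substack{m,j \geq 0 \\ N = 2m+nj}}\frac{n(j+k)\,\Gamma(nk)}{2^{2m+nj}\,m!\,\Gamma(n(j+k)+m+1)}\,C_j^{(k)}(\cos \xi) = \sum_{\substack{j_1, \ldots, j_n \geq 0 \\ j_1+\cdots+ j_n = N}} \frac{(k)_{j_1}\cdots (k)_{j_{n}}}{(nk)_{N}}\, \frac{b_1^{j_1}}{j_1!}\cdots \frac{b_{n}^{j_{n}}}{j_{n}!},$$ where the left-hand sum runs over all pairs $(m,j)$ of non-negative integers with $2m+nj=N$ (an empty sum being $0$) and the right-hand sum runs over all $n$-tuples of non-negative integers with sum $N$.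
   Context: $(x)_l := x(x+1)\cdots(x+l-1)$, with $(x)_0 := 1$, is the Pochhammer symbol, and $\Gamma$ is the Gamma function. For $k>0$ and an integer $j\ge 0$, $C_j^{(k)}$ is the $j$-th Gegenbauer polynomial of parameter $k$, determined by $\sum_{j\ge 0} C_j^{(k)}(\cos\xi)\,w^j = (1-2w\cos\xi+w^2)^{-k}$ for $|w|<1$; equivalently $C_j^{(k)}(x) = \frac{(2k)_j}{j!}\,{}_2F_1\left(-j,j+2k;k+\tfrac12;\tfrac{1-x}{2}\right)$, so that $C_j^{(k)}(1) = (2k)_j/j!$. *)

theory Defs
  imports "HOL-Complex_Analysis.Complex_Analysis"
begin

text \<open>
  The Gegenbauer polynomial, given by
  \<open>(2k)\<^sub>j / j! * \<^sub>2F\<^sub>1(-j, j + 2k; k + 1/2; (1 - x)/2)\<close>. The hypergeometric series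
  terminates because \<open>(-j)\<^sub>i = 0\<close> for \<open>i > j\<close>, and \<open>[:1/2, -1/2:]\<close> is \<open>(1 - x)/2\<close>. The generating
  function is established in \<open>gegenbauer_generating_function\<close>.
\<close>

definition gegenbauer_poly :: "real \<Rightarrow> nat \<Rightarrow> real poly" where
  "gegenbauer_poly k j =
     smult (pochhammer (2 * k) j / fact j)
       (\<Sum>i\<le>j. smult (pochhammer (- real j) i * pochhammer (real j + 2 * k) i /
                      (pochhammer (k + 1/2) i * fact i))
                     ([:1/2, -1/2:] ^ i))"

lemma poly_gegenbauer_poly:
  "poly (gegenbauer_poly k j) x =
     pochhammer (2 * k) j / fact j *
     (\<Sum>i\<le>j. pochhammer (- real j) i * pochhammer (real j + 2 * k) i /
             (pochhammer (k + 1/2) i * fact i) * ((1 - x) / 2) ^ i)"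
  by (simp add: gegenbauer_poly_def poly_sum diff_divide_distrib)

lemma poly_gegenbauer_poly_1: "poly (gegenbauer_poly k j) 1 = pochhammer (2 * k) j / fact j"
proof -
  have "(\<Sum>i\<le>j. pochhammer (- real j) i * pochhammer (real j + 2 * k) i /
             (pochhammer (k + 1/2) i * fact i) * ((1 - 1) / 2) ^ i) = (\<Sum>i\<le>j. if i = 0 then 1 else 0)"
    by (intro sum.cong) auto
  thus ?thesis by (simp add: poly_gegenbauer_poly)
qed

lemma gegenbauer_coeff:
  assumes "i \<le> j"
  shows "pochhammer (2 * k) j / fact j * (pochhammer (- real j) i * pochhammer (real j + 2 * k) i /
           (pochhammer (k + 1/2) i * fact i)) =
         (-1) ^ i * pochhammer (2 * k) (j + i) / (fact (j - i) * pochhammer (k + 1/2) i * fact i)"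
proof -
  have "pochhammer (- real j) i * fact (j - i) = (-1) ^ i * fact j"
    using assms
  proof (induction i)
    case (Suc i)
    hence *: "fact (j - i) = (real j - real i) * fact (j - Suc i)"
      using fact_reduce[of "j - i", where 'a = real] by (simp add: of_nat_diff)
    have "pochhammer (- real j) (Suc i) * fact (j - Suc i) =
            - (pochhammer (- real j) i * fact (j - i))"
      unfolding * by (simp add: pochhammer_Suc algebra_simps)
    thus ?case using Suc by simp
  qed simp
  hence a: "pochhammer (- real j) i = (-1) ^ i * fact j / fact (j - i)"
    by (simp add: field_simps)
  have b: "pochhammer (2 * k) (j + i) = pochhammer (2 * k) j * pochhammer (real j + 2 * k) i"
    by (simp only: pochhammer_product' add.commute[of "2 * k" "real j"])
  show ?thesis unfolding a b by (simp add: mult_ac)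
qed

lemma gegenbauer_recurrence:
  assumes "k > 0"
  shows "real (j + 2) * poly (gegenbauer_poly k (j + 2)) x =
           2 * (real j + 1 + k) * x * poly (gegenbauer_poly k (j + 1)) x -
           (real j + 2 * k) * poly (gegenbauer_poly k j) x"
proof -
  define a where "a = (\<lambda>j i. if i \<le> j then (-1) ^ i * pochhammer (2 * k) (j + i) /
           (fact (j - i) * pochhammer (k + 1/2) i * fact i) else 0)"
  define u where "u = (1 - x) / 2"
  have C: "poly (gegenbauer_poly k l) x = (\<Sum>i\<le>M. a l i * u ^ i)" if "l \<le> M" for l M
  proof -
    have "poly (gegenbauer_poly k l) x = (\<Sum>i\<le>l. a l i * u ^ i)"
      unfolding poly_gegenbauer_poly sum_distrib_left
      by (intro sum.cong refl, subst mult.assoc [symmetric], subst gegenbauer_coeff)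
         (auto simp: a_def u_def)
    also have "\<dots> = (\<Sum>i\<le>M. a l i * u ^ i)"
      using that by (intro sum.mono_neutral_left) (auto simp: a_def)
    finally show ?thesis .
  qed
  have nz: "pochhammer (k + 1/2) i \<noteq> 0" for i
    using assms by (intro pochhammer_pos[THEN less_imp_neq, symmetric]) simp
  have rec0: "real (j + 2) * a (j + 2) 0 = 2 * (real j + 1 + k) * a (j + 1) 0 - (real j + 2 * k) * a j 0"
    by (simp add: a_def pochhammer_Suc divide_simps) (simp add: algebra_simps)
  have rec: "real (j + 2) * a (j + 2) (Suc i) =
      2 * (real j + 1 + k) * (a (j + 1) (Suc i) - 2 * a (j + 1) i) - (real j + 2 * k) * a j (Suc i)" for i
  proof -
    consider "i > j + 1" | "i = j + 1" | "i = j" | "i < j" by linarith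
    thus ?thesis
    proof cases
      case 4
      then obtain d where j: "j = Suc (i + d)" using less_imp_Suc_add by blast
      have "Suc (Suc j) - i = Suc (Suc (Suc d))" "j - i = Suc d" "Suc j - i = Suc (Suc d)" using j by auto
      note j' = this
      have "k + 1 / 2 + real i \<noteq> 0" using assms by linarith
      define P where "P = pochhammer (2 * k) (j + i + 1)"
      have P: "pochhammer (2 * k) (j + i + 2) = P * (2 * k + j + i + 1)"
              "pochhammer (2 * k) (j + i + 3) = P * (2 * k + j + i + 1) * (2 * k + j + i + 2)"
        by (simp_all add: P_def pochhammer_Suc numeral_3_eq_3 add_ac)
      define B where "B = (-1) ^ i * P / (fact (d + 2) * pochhammer (k + 1/2) (i + 1) * fact (i + 1))"
      have e1: "a (j + 2) (Suc i) = - B * (2 * k + j + i + 1) * (2 * k + j + i + 2)"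
        using j P by (simp add: a_def B_def j' numeral_3_eq_3)
      have e2: "a (j + 1) (Suc i) = - B * (2 * k + j + i + 1) * (d + 2)"
        using j P nz by (simp add: a_def B_def j' numeral_3_eq_3 divide_simps)
      have e3: "a (j + 1) i = B * (k + 1/2 + i) * (i + 1)"
        using j P nz \<open>k + 1 / 2 + real i \<noteq> 0\<close>
        by (simp add: a_def B_def j' numeral_3_eq_3 P_def pochhammer_Suc[of "k+1/2" i])
      have e4: "a j (Suc i) = - B * (d + 2) * (d + 1)"
        using j P nz by (simp add: a_def B_def j' numeral_3_eq_3 divide_simps P_def)
      have j_real: "real j = real i + real d + 1" using j by simp
      have j2_real: "real (j + 2) = real i + real d + 3" using j by simp
      show ?thesis unfolding e1 e2 e3 e4 unfolding j2_real j_real by (simp add: field_simps)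
    next
      case 3
      have "k + 1 / 2 + real i \<noteq> 0" using assms by linarith
      thus ?thesis using nz 3 
        by (simp add: a_def pochhammer_Suc divide_simps) (simp add: algebra_simps)
    next
      case 2
      have "k + 1 / 2 + real i \<noteq> 0" using assms by linarith
      thus ?thesis using nz 2 
        by (simp add: a_def pochhammer_Suc divide_simps) (simp add: algebra_simps)
    qed (simp add: a_def)
  qed
  have x: "x = 1 - 2 * u" by (simp add: u_def field_simps)
  define M where "M = Suc (j + 2)"
  have s1: "(\<Sum>i\<le>Suc M. f i) = f 0 + (\<Sum>i\<le>M. f (Suc i))" for f :: "nat \<Rightarrow> real"
    by (rule sum.atMost_Suc_shift)
  define S0 where "S0 = (\<Sum>i\<le>M. a j (Suc i) * u ^ Suc i)"
  define S1 where "S1 = (\<Sum>i\<le>M. a (j + 1) (Suc i) * u ^ Suc i)"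
  define S1' where "S1' = (\<Sum>i\<le>M. a (j + 1) i * u ^ i)"
  define S2 where "S2 = (\<Sum>i\<le>M. a (j + 2) (Suc i) * u ^ Suc i)"
  have p0: "poly (gegenbauer_poly k j) x = a j 0 + S0"
    using C[of j "Suc M"] unfolding s1 S0_def by (simp add: M_def)
  have p1: "poly (gegenbauer_poly k (j + 1)) x = a (j + 1) 0 + S1"
    using C[of "j + 1" "Suc M"] unfolding s1 S1_def by (simp add: M_def)
  have p1': "poly (gegenbauer_poly k (j + 1)) x = S1'"
    using C[of "j + 1" M] unfolding S1'_def by (simp add: M_def)
  have p2: "poly (gegenbauer_poly k (j + 2)) x = a (j + 2) 0 + S2"
    using C[of "j + 2" "Suc M"] unfolding s1 S2_def by (simp add: M_def)
  have "real (j + 2) * S2 = (\<Sum>i\<le>M. real (j + 2) * a (j + 2) (Suc i) * u ^ Suc i)"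
    unfolding S2_def sum_distrib_left by (simp only: mult.assoc)
  also have "\<dots> = (\<Sum>i\<le>M. 2 * (real j + 1 + k) * (a (j + 1) (Suc i) * u ^ Suc i - 2 * u * (a (j + 1) i * u ^ i)) -
                          (real j + 2 * k) * (a j (Suc i) * u ^ Suc i))"
    unfolding rec by (intro sum.cong refl) (simp add: algebra_simps)
  also have "\<dots> = 2 * (real j + 1 + k) * (S1 - 2 * u * S1') - (real j + 2 * k) * S0"
    unfolding S0_def S1_def S1'_def sum_subtractf
    unfolding sum_distrib_left [symmetric] sum_subtractf
    unfolding sum_distrib_left [symmetric] ..
  finally have S2: "real (j + 2) * S2 = \<dots>" .
  have "real (j + 2) * (a (j + 2) 0 + S2) =
           2 * (real j + 1 + k) * ((a (j + 1) 0 + S1) - 2 * u * S1') - (real j + 2 * k) * (a j 0 + S0)"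
    unfolding distrib_left [of "real (j + 2)"] rec0 S2 by (simp add: algebra_simps)
  also have "(a (j + 1) 0 + S1) - 2 * u * S1' = x * poly (gegenbauer_poly k (j + 1)) x"
    unfolding p1 [symmetric] p1' [symmetric] x by (simp add: algebra_simps)
  finally show ?thesis
    unfolding p0 p2 by (simp only: mult.assoc)
qed

lemma gegenbauer_base_not_nonpos:
  assumes "norm (w :: complex) < 1"
  shows "1 - 2 * w * of_real (cos \<xi>) + w\<^sup>2 \<notin> \<real>\<^sub>\<le>\<^sub>0"
proof -
  have f: "1 - 2 * w * of_real (cos \<xi>) + w\<^sup>2 = (1 - w * cis \<xi>) * (1 - w * cis (-\<xi>))"
    by (simp add: complex_eq_iff cis.simps power2_eq_square algebra_simps)
  have 1: "Re (w * cis t) < 1" for t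
    using complex_Re_le_cmod[of "w * cis t"] assms by (simp add: norm_mult)
  hence r: "Re (1 - w * cis t) > 0" for t by (simp only: minus_complex.sel one_complex.sel diff_gt_0_iff_gt)
  have *: "u * v \<notin> \<real>\<^sub>\<le>\<^sub>0" if "Re u > 0" "Re v > 0" for u v :: complex
  proof
    assume "u * v \<in> \<real>\<^sub>\<le>\<^sub>0"
    hence a: "Re u * Re v \<le> Im u * Im v" and b: "Re u * Im v = - Im u * Re v"
      by (auto simp: complex_nonpos_Reals_iff)
    have "0 < Re u * Re v * Re v" using that by simp
    also have "\<dots> \<le> Im u * Im v * Re v" using a that by (intro mult_right_mono) auto
    also have "\<dots> = - Re u * (Im v)\<^sup>2" using b by (simp add: power2_eq_square algebra_simps)
    also have "\<dots> \<le> 0" using that by simp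
    finally show False by simp
  qed
  show ?thesis unfolding f by (intro * r)
qed

theorem gegenbauer_generating_function_complex:
  fixes w :: complex
  assumes k: "k > 0" and w: "norm w < 1"
  shows "(\<lambda>j. of_real (poly (gegenbauer_poly k j) (cos \<xi>)) * w ^ j) sums
           ((1 - 2 * w * of_real (cos \<xi>) + w\<^sup>2) powr of_real (-k))"
proof -
  define x where "x = cos \<xi>"
  define c :: complex where "c = of_real x"
  define f where "f = (\<lambda>w. (1 - 2 * w * c + w\<^sup>2) powr (- of_real k))"
  define f' where "f' = (\<lambda>w. (- of_real k) * (2 * w - 2 * c) * (1 - 2 * w * c + w\<^sup>2) powr (- of_real k - 1))"
  have np: "1 - 2 * w * c + w\<^sup>2 \<notin> \<real>\<^sub>\<le>\<^sub>0" if "norm w < 1" for w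
    using gegenbauer_base_not_nonpos[OF that, of \<xi>] by (simp add: c_def x_def)
  have df: "(f has_field_derivative f' w) (at w)" if "norm w < 1" for w
    unfolding f_def f'_def using np[OF that]
    by (auto intro!: derivative_eq_intros simp: algebra_simps)
  have hol: "f holomorphic_on ball 0 1"
    using df by (fastforce simp: holomorphic_on_open)
  define F where "F = fps_expansion f 0"
  have F: "f has_fps_expansion F"
    unfolding F_def using hol by (intro has_fps_expansion_fps_expansion[of "ball 0 1"]) auto
  have G: "(\<lambda>w. (1 - 2 * c * w + w ^ 2) * deriv f w) has_fps_expansion
          (1 - fps_const (2 * c) * fps_X + fps_X ^ 2) * fps_deriv F"
    by (intro fps_expansion_intros has_fps_expansion_deriv F)
  have H: "(\<lambda>w. 2 * of_real k * (c - w) * f w) has_fps_expansion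
          fps_const (2 * of_real k) * (fps_const c - fps_X) * F"
    by (intro fps_expansion_intros F)
  have ev: "eventually (\<lambda>w. (1 - 2 * c * w + w ^ 2) * deriv f w = 2 * of_real k * (c - w) * f w) (nhds 0)"
  proof -
    have "eventually (\<lambda>w. w \<in> ball 0 1) (nhds (0 :: complex))"
      by (intro eventually_nhds_in_open) auto
    thus ?thesis
    proof eventually_elim
      case (elim w)
      hence "norm w < 1" by simp
      from np[OF this] have "1 - 2 * w * c + w\<^sup>2 \<noteq> 0" by auto
      thus ?case
        using DERIV_imp_deriv[OF df[OF \<open>norm w < 1\<close>]]
        by (simp add: f'_def f_def powr_diff field_simps)
    qed
  qed
  have "(\<lambda>w. (1 - 2 * c * w + w ^ 2) * deriv f w) has_fps_expansion
          fps_const (2 * of_real k) * (fps_const c - fps_X) * F"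
    using has_fps_expansion_cong[OF ev refl] H by (rule iffD2)
  with G have eq: "(1 - fps_const (2 * c) * fps_X + fps_X ^ 2) * fps_deriv F = 
     fps_const (2 * of_real k) * (fps_const c - fps_X) * F"
    by (rule fps_expansion_unique_complex)
  have F0: "fps_nth F 0 = 1" using has_fps_expansion_imp_0_eq_fps_nth_0[OF F] by (simp add: f_def)
  have F1: "fps_nth F 1 = 2 * of_real k * c"
    using arg_cong[OF eq, of "\<lambda>f. fps_nth f 0"] F0 by (simp add: algebra_simps power2_eq_square)
  have Frec: "of_nat (j + 2) * fps_nth F (j + 2) =
       2 * (of_nat j + 1 + of_real k) * c * fps_nth F (j + 1) - (of_nat j + 2 * of_real k) * fps_nth F j" for j
  proof -
    have "(1 - fps_const (2 * c) * fps_X + fps_X ^ 2) * fps_deriv F = 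
           fps_deriv F - fps_const (2 * c) * (fps_X * fps_deriv F) + fps_X ^ 2 * fps_deriv F"
      by (simp add: algebra_simps)
    also have "fps_nth \<dots> (Suc j) = of_nat (j + 2) * fps_nth F (j + 2) - 2 * c * of_nat (j + 1) * fps_nth F (j + 1)
        + (if j = 0 then 0 else of_nat j * fps_nth F j)"
      by (cases j) (simp_all add: fps_X_power_mult_nth)
    also have "\<dots> = of_nat (j + 2) * fps_nth F (j + 2) - 2 * c * of_nat (j + 1) * fps_nth F (j + 1)
        + of_nat j * fps_nth F j" by simp
    finally have 1: "fps_nth ((1 - fps_const (2 * c) * fps_X + fps_X ^ 2) * fps_deriv F) (Suc j) = \<dots>" .
    have "fps_const (2 * of_real k) * (fps_const c - fps_X) * F =
          fps_const (2 * of_real k * c) * F - fps_const (2 * of_real k) * (fps_X * F)"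
      by (simp only: left_diff_distrib right_diff_distrib fps_const_mult [symmetric] mult.assoc)
    also have "fps_nth \<dots> (Suc j) = 2 * of_real k * c * fps_nth F (j + 1) - 2 * of_real k * fps_nth F j"
      by simp
    finally show ?thesis using 1 unfolding eq by (simp add: algebra_simps)
  qed
  have Fj: "fps_nth F j = of_real (poly (gegenbauer_poly k j) x)" for j
  proof (induction j rule: induct_nat_012)
    case 0
    show ?case by (simp add: F0 gegenbauer_poly_def)
  next
    case 1
    have "poly (gegenbauer_poly k 1) x = 2 * k * x"
      using k by (simp add: poly_gegenbauer_poly field_simps)
    thus ?case using F1 by (simp add: c_def)
  next
    case (ge2 j)
    have "of_nat (j + 2) * fps_nth F (j + 2) = of_real (real (j + 2) * poly (gegenbauer_poly k (j + 2)) x)"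
      unfolding gegenbauer_recurrence[OF k] Frec using ge2 by (simp add: c_def)
    hence "of_nat (j + 2) * fps_nth F (j + 2) = of_nat (j + 2) * of_real (poly (gegenbauer_poly k (j + 2)) x)"
      by simp
    hence "fps_nth F (j + 2) = of_real (poly (gegenbauer_poly k (j + 2)) x)"
      unfolding mult_cancel_left of_nat_eq_0_iff by simp
    thus ?case by simp
  qed
  have "(\<lambda>j. (deriv ^^ j) f 0 / fact j * (w - 0) ^ j) sums f w"
    using hol w by (intro holomorphic_power_series[of f 0 1]) auto
  moreover have "(deriv ^^ j) f 0 / fact j = of_real (poly (gegenbauer_poly k j) x)" for j
    using Fj[of j] by (simp add: F_def fps_expansion_def)
  ultimately have "(\<lambda>j. of_real (poly (gegenbauer_poly k j) x) * w ^ j) sums f w"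
    by (simp only: diff_zero)
  thus ?thesis
    by (simp add: f_def c_def x_def)
qed

theorem gegenbauer_generating_function:
  fixes w :: real
  assumes "k > 0" and "\<bar>w\<bar> < 1"
  shows "(\<lambda>j. poly (gegenbauer_poly k j) (cos \<xi>) * w ^ j) sums
           ((1 - 2 * w * cos \<xi> + w\<^sup>2) powr (-k))"
proof -
  let ?b = "1 - 2 * w * cos \<xi> + w\<^sup>2"
  have b: "?b \<ge> 0"
  proof -
    have "?b = (w - cos \<xi>)\<^sup>2 + (sin \<xi>)\<^sup>2"
      by (simp add: power2_eq_square algebra_simps)
    thus ?thesis by simp
  qed
  have "(\<lambda>j. of_real (poly (gegenbauer_poly k j) (cos \<xi>)) * complex_of_real w ^ j) sums
           ((1 - 2 * of_real w * of_real (cos \<xi>) + (of_real w)\<^sup>2) powr of_real (-k))"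
    using assms by (intro gegenbauer_generating_function_complex) auto
  also have "(1 - 2 * complex_of_real w * of_real (cos \<xi>) + (of_real w)\<^sup>2) powr of_real (-k) = of_real (?b powr (-k))"
    using powr_of_real[OF b, of "-k"] by simp
  finally have "(\<lambda>j. complex_of_real (poly (gegenbauer_poly k j) (cos \<xi>) * w ^ j)) sums of_real (?b powr (-k))"
    by simp
  thus ?thesis by (simp only: sums_of_real_iff)
qed

end

theory Submission
  imports Defs
begin

text \<open>
  Up to the factor \<open>(nk)\<^sub>N\<close>, the right-hand side is the \<open>N\<close>-th coefficient of
  \<open>\<Prod>\<^sub>s (1 - b\<^sub>s t) powr (-k)\<close>; with \<open>2t\<close> in place of \<open>t\<close> this product is a power series \<open>F(t)\<close>.
  Substituting \<open>t = w / (1 + w\<^sup>2)\<close> turns each factor into \<open>(1 - 2 b\<^sub>s w + w\<^sup>2) / (1 + w\<^sup>2)\<close>, and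
  \<open>\<Prod>\<^sub>s (1 - 2 b\<^sub>s w + w\<^sup>2) = 1 - 2 cos \<xi> w\<^sup>n + w\<^bsup>2n\<^esup>\<close> (\<open>prod_chebyshev\<close>), since the numbers
  \<open>cis ((\<xi> + 2\<pi>s) / n)\<close> are the \<open>n\<close>-th roots of \<open>cis \<xi>\<close>. By the generating function of the
  Gegenbauer polynomials (\<open>compose_prod_eq_gegenbauer\<close>),
    \<open>F(w / (1 + w\<^sup>2)) = (1 + w\<^sup>2) powr (nk) * \<Sum>\<^sub>j C\<^sub>j(cos \<xi>) w\<^bsup>nj\<^esup>\<close>.

  Lagrange inversion (\<open>fps_lagrange\<close>) recovers the \<open>N\<close>-th coefficient of \<open>F\<close> as that of
    \<open>(\<Sum>\<^sub>j C\<^sub>j(cos \<xi>) w\<^bsup>nj\<^esup>) * (1 - w\<^sup>2) * (1 + w\<^sup>2) powr (nk + N - 1)\<close>.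
  For \<open>N = 2m + nj\<close> the last two factors contribute a difference of two consecutive binomial
  coefficients, which is the quotient of Gamma values on the left-hand side
  (\<open>fps_nth_one_minus_X_binomial\<close>).

  All this takes place in formal power series. A power with real exponent is characterised there by
  its first-order linear differential equation (\<open>is_fps_powr\<close>), so that no question of convergence
  or of branches arises.
\<close>

section \<open>Coefficient formulas for formal power series\<close>

lemma fps_nth_prod_PiE:
  fixes f :: "'b \<Rightarrow> 'a :: comm_semiring_1 fps"
  assumes "finite A"
  shows "fps_nth (\<Prod>x\<in>A. f x) N =
           (\<Sum>J \<in> {J \<in> A \<rightarrow>\<^sub>E UNIV. (\<Sum>x\<in>A. J x) = N}. \<Prod>x\<in>A. fps_nth (f x) (J x))"
proof -
  have cnt: "count (\<Sum>y\<in>A. replicate_mset (J y) y) x = (if x \<in> A then J x else 0)"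
    for J :: "'b \<Rightarrow> nat" and x
  proof -
    have "count (\<Sum>y\<in>A. replicate_mset (J y) y) x = (\<Sum>y\<in>A. if y = x then J x else 0)"
      unfolding count_sum by (intro sum.cong) auto
    also have "\<dots> = (if x \<in> A then J x else 0)"
      using assms by (simp add: sum.delta)
    finally show ?thesis .
  qed
  show ?thesis
    unfolding fps_prod_nth'[OF assms]
  proof (rule sum.reindex_bij_witness[where
        i = "\<lambda>J. \<Sum>x\<in>A. replicate_mset (J x) x" and j = "\<lambda>X. restrict (count X) A"], goal_cases)
    case (1 X)
    then have "set_mset X \<subseteq> A" by (rule multisets_of_size_subset)
    then have "count X x = 0" if "x \<notin> A" for x
      using that by (meson not_in_iff subsetD)
    then show ?case
      by (intro multiset_eqI) (simp add: cnt)
  next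
    case (2 X)
    then have X: "set_mset X \<subseteq> A" "size X = N"
      by (rule multisets_of_size_subset, rule multisets_of_size_size)
    have "size X = (\<Sum>x\<in>A. count X x)"
      unfolding size_multiset_overloaded_eq using assms X(1)
      by (intro sum.mono_neutral_left) (simp_all add: count_eq_zero_iff)
    with X show ?case by simp
  next
    case (3 J)
    then have "J \<in> A \<rightarrow>\<^sub>E UNIV" by simp
    then show ?case by (intro extensionalityI[of _ A]) (simp_all add: cnt PiE_def)
  next
    case (4 J)
    have "set_mset (\<Sum>x\<in>A. replicate_mset (J x) x) \<subseteq> A"
      by (force simp: count_greater_zero_iff [symmetric] cnt
            split: if_splits simp del: count_greater_zero_iff)
    moreover have "size (\<Sum>x\<in>A. replicate_mset (J x) x) = N"
      using 4 by simp
    ultimately show ?case by (simp add: multisets_of_size_def)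
  next
    case (5 X)
    show ?case by (intro prod.cong) simp_all
  qed
qed

lemma fps_compose_X_power_nth:
  fixes A :: "'a :: idom fps"
  assumes "p > 0"
  shows "fps_nth (A oo fps_X ^ p) i = (if p dvd i then fps_nth A (i div p) else 0)"
proof -
  have "fps_nth (A oo fps_X ^ p) i = (\<Sum>j=0..i. if i = p * j then fps_nth A j else 0)"
    unfolding fps_compose_nth by (intro sum.cong) (auto simp: power_mult [symmetric])
  also have "\<dots> = (\<Sum>j=0..i. if p dvd i \<and> j = i div p then fps_nth A j else 0)"
    using assms by (intro sum.cong) auto
  also have "\<dots> = (if p dvd i then fps_nth A (i div p) else 0)"
    by (auto simp: sum.delta)
  finally show ?thesis .
qed

lemma fps_nth_mult_compose_X_powers:
  fixes A B :: "'a :: idom fps"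
  assumes p: "p > 0" and q: "q > 0"
  shows "fps_nth ((A oo fps_X ^ p) * (B oo fps_X ^ q)) N =
           (\<Sum>(m, j) \<in> {(m, j). N = q * m + p * j}. fps_nth A j * fps_nth B m)"
proof -
  have "fps_nth ((A oo fps_X ^ p) * (B oo fps_X ^ q)) N =
          (\<Sum>i = 0..N. fps_nth (A oo fps_X ^ p) i * fps_nth (B oo fps_X ^ q) (N - i))"
    by (rule fps_mult_nth)
  also have "\<dots> = (\<Sum>i \<in> {i \<in> {0..N}. p dvd i \<and> q dvd (N - i)}.
                      fps_nth A (i div p) * fps_nth B ((N - i) div q))"
    by (intro sum.mono_neutral_cong_right) (auto simp: fps_compose_X_power_nth p q)
  also have "\<dots> = (\<Sum>(m, j) \<in> {(m, j). N = q * m + p * j}. fps_nth A j * fps_nth B m)"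
    using p q
    by (intro sum.reindex_bij_witness[where
          i = "\<lambda>(m, j). p * j" and j = "\<lambda>i. ((N - i) div q, i div p)"]) auto
  finally show ?thesis .
qed

text \<open>
  The form of Lagrange inversion that needs no compositional inverse. Both sides are linear in \<open>F\<close>,
  so it suffices to treat \<open>F = X ^ j\<close>. Then the series on the right is
  \<open>X ^ j * \<phi> ^ d * (1 - X \<phi>' / \<phi>)\<close> with \<open>d = N - j\<close>. For \<open>d > 0\<close> its last two factors equal
  \<open>\<phi> ^ d - X (\<phi> ^ d)' / d\<close>, whose \<open>d\<close>-th coefficient vanishes.
\<close>
lemma fps_lagrange:
  fixes F \<phi> :: "'a :: field_char_0 fps"
  assumes "fps_nth \<phi> 0 \<noteq> 0"
  shows "fps_nth F N =
    fps_nth ((F oo (fps_X * inverse \<phi>)) * (\<phi> ^ N * (1 - fps_X * fps_deriv \<phi> * inverse \<phi>))) N"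
proof -
  define T where "T = fps_X * inverse \<phi>"
  define W where "W = 1 - fps_X * fps_deriv \<phi> * inverse \<phi>"
  have T0: "fps_nth T 0 = 0" by (simp add: T_def)
  have inv: "\<phi> * inverse \<phi> = 1" using assms by (simp add: inverse_mult_eq_1')
  have key: "fps_nth (\<phi> ^ d * W) d = (if d = 0 then 1 else 0)" for d
  proof (cases d)
    case 0
    then show ?thesis by (simp add: W_def)
  next
    case (Suc e)
    define D where "D = fps_deriv \<phi> * \<phi> ^ e"
    have "\<phi> ^ d * W = \<phi> ^ d - fps_X * fps_deriv \<phi> * \<phi> ^ e * (\<phi> * inverse \<phi>)"
      by (simp add: W_def Suc algebra_simps)
    then have eq: "\<phi> ^ d * W = \<phi> ^ d - fps_X * D"
      by (simp add: inv D_def mult.assoc)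
    have "fps_deriv (\<phi> ^ d) = fps_const (of_nat d) * D"
      by (simp add: fps_deriv_power Suc D_def mult.assoc del: power_Suc)
    then have "fps_nth (fps_deriv (\<phi> ^ d)) e = of_nat d * fps_nth D e"
      by simp
    then have "of_nat d * fps_nth (\<phi> ^ d) d = of_nat d * fps_nth D e"
      by (simp add: Suc del: power_Suc of_nat_Suc)
    then have "fps_nth (\<phi> ^ d) d = fps_nth D e"
      using Suc by (simp del: of_nat_Suc power_Suc)
    then show ?thesis
      unfolding eq by (simp add: Suc del: power_Suc)
  qed
  have summand: "fps_nth (T ^ j * (\<phi> ^ N * W)) N = (if j = N then 1 else 0)" if "j \<le> N" for j
  proof -
    have "T ^ j * \<phi> ^ N = fps_X ^ j * (\<phi> * inverse \<phi>) ^ j * \<phi> ^ (N - j)"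
      using that by (simp add: T_def power_mult_distrib mult_ac power_add [symmetric])
    then have "T ^ j * (\<phi> ^ N * W) = fps_X ^ j * (\<phi> ^ (N - j) * W)"
      by (simp only: inv power_one mult_1_right mult.assoc [symmetric])
    then show ?thesis
      using that key[of "N - j"] by (simp only: fps_X_power_mult_nth) auto
  qed
  have "fps_nth ((F oo T) * (\<phi> ^ N * W)) N =
          (\<Sum>i=0..N. (\<Sum>j=0..N. fps_nth F j * fps_nth (T ^ j) i) * fps_nth (\<phi> ^ N * W) (N - i))"
    unfolding fps_mult_nth[of "F oo T"] fps_compose_nth
    by (intro sum.cong refl arg_cong2[where f = "(*)"] sum.mono_neutral_left)
       (auto simp: startsby_zero_power_prefix[OF T0])
  also have "\<dots> = (\<Sum>j=0..N. fps_nth F j * fps_nth (T ^ j * (\<phi> ^ N * W)) N)"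
    unfolding fps_mult_nth[of "T ^ _"] sum_distrib_left sum_distrib_right
    by (subst sum.swap) (simp only: mult.assoc)
  also have "\<dots> = (\<Sum>j=0..N. if j = N then fps_nth F j else 0)"
    by (intro sum.cong) (auto simp: summand)
  also have "\<dots> = fps_nth F N"
    by simp
  finally show ?thesis
    by (simp add: T_def W_def)
qed

section \<open>Powers of a power series with arbitrary exponent\<close>

text \<open>
  \<open>Y\<close> is the \<open>c\<close>-th power of the series \<open>U\<close>: both have constant coefficient 1 and
  \<open>Y' / Y = c U' / U\<close>, written without division. A relation rather than a function is used because
  the powers below arise as given series that are recognised by this equation; \<open>Y\<close> is determined
  by \<open>c\<close> and \<open>U\<close> (\<open>is_fps_powr_unique\<close>).
\<close>
definition is_fps_powr :: "'a :: field_char_0 \<Rightarrow> 'a fps \<Rightarrow> 'a fps \<Rightarrow> bool" where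
  "is_fps_powr c U Y \<longleftrightarrow> fps_nth U 0 = 1 \<and> fps_nth Y 0 = 1 \<and>
     U * fps_deriv Y = fps_const c * fps_deriv U * Y"

lemma is_fps_powr_unique:
  assumes Y: "is_fps_powr c U Y" and Z: "is_fps_powr c U Z"
  shows "Y = Z"
proof -
  have nz: "fps_nth U 0 \<noteq> 0" "U \<noteq> 0" using Y by (auto simp: is_fps_powr_def)
  have nz': "fps_nth Z 0 \<noteq> 0" "Z \<noteq> 0" using Z by (auto simp: is_fps_powr_def)
  have "U * (fps_deriv Y * Z - Y * fps_deriv Z) = (U * fps_deriv Y) * Z - Y * (U * fps_deriv Z)"
    by (simp add: algebra_simps)
  also have "\<dots> = 0"
    using Y Z by (simp add: is_fps_powr_def mult_ac)
  \<comment> \<open>The Wronskian of \<open>Y\<close> and \<open>Z\<close> vanishes, so \<open>Y / Z\<close> is constant.\<close>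
  finally have *: "fps_deriv Y * Z = Y * fps_deriv Z" using nz by simp
  have inv: "Z * inverse Z = 1" using nz' by (simp add: inverse_mult_eq_1')
  have "fps_deriv (Y * inverse Z) = (fps_deriv Y * Z - Y * fps_deriv Z) * (inverse Z)\<^sup>2"
  proof -
    have "fps_deriv (Y * inverse Z) = fps_deriv Y * inverse Z - Y * fps_deriv Z * (inverse Z)\<^sup>2"
      using nz' by (simp add: fps_inverse_deriv algebra_simps)
    also have "fps_deriv Y * inverse Z = fps_deriv Y * inverse Z * (Z * inverse Z)"
      by (simp only: inv mult_1_right)
    finally show ?thesis by (simp add: algebra_simps power2_eq_square)
  qed
  also have "\<dots> = 0" by (simp add: *)
  finally obtain a where a: "Y * inverse Z = fps_const a"
    unfolding fps_deriv_eq_0_iff by blast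
  have "a = fps_nth (Y * inverse Z) 0" by (simp add: a)
  also have "\<dots> = 1" using Y Z by (simp add: is_fps_powr_def)
  finally have "Y * inverse Z = 1" using a by simp
  then have "Y * (Z * inverse Z) = Z" by (simp add: mult_ac)
  then show ?thesis by (simp only: inv mult_1_right)
qed

lemma is_fps_powr_1: "is_fps_powr c 1 1"
  by (simp add: is_fps_powr_def)

lemma is_fps_powr_mult:
  assumes "is_fps_powr c U Y" "is_fps_powr c V Z"
  shows "is_fps_powr c (U * V) (Y * Z)"
proof -
  have "(U * V) * fps_deriv (Y * Z) = (U * fps_deriv Y) * V * Z + (V * fps_deriv Z) * U * Y"
    by (simp add: algebra_simps)
  also have "\<dots> = fps_const c * fps_deriv (U * V) * (Y * Z)"
    using assms by (simp add: is_fps_powr_def algebra_simps)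
  finally show ?thesis
    using assms by (simp add: is_fps_powr_def)
qed

lemma is_fps_powr_prod:
  assumes "\<And>x. x \<in> A \<Longrightarrow> is_fps_powr c (U x) (Y x)"
  shows "is_fps_powr c (\<Prod>x\<in>A. U x) (\<Prod>x\<in>A. Y x)"
  using assms
  by (induction A rule: infinite_finite_induct) (auto simp: is_fps_powr_1 is_fps_powr_mult)

lemma is_fps_powr_base_power:
  assumes "is_fps_powr (of_nat n * c) U Y"
  shows "is_fps_powr c (U ^ n) Y"
proof (cases n)
  case 0
  have "fps_nth U 0 \<noteq> 0" "U \<noteq> 0" using assms by (auto simp: is_fps_powr_def)
  then have "fps_deriv Y = 0" using assms 0 by (simp add: is_fps_powr_def del: fps_deriv_eq_0_iff)
  then show ?thesis using assms 0 by (simp add: is_fps_powr_def del: fps_deriv_eq_0_iff)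
next
  case (Suc m)
  have "U ^ n * fps_deriv Y = U ^ m * (U * fps_deriv Y)"
    by (simp add: Suc mult_ac)
  also have "\<dots> = U ^ m * (fps_const (of_nat n * c) * fps_deriv U * Y)"
    using assms by (simp add: is_fps_powr_def)
  also have "\<dots> = fps_const c * fps_deriv (U ^ n) * Y"
    by (simp add: fps_deriv_power Suc mult_ac fps_const_mult [symmetric] 
             del: fps_const_mult power_Suc of_nat_Suc)
  finally show ?thesis
    using assms by (simp add: is_fps_powr_def fps_nth_power_0)
qed

lemma is_fps_powr_compose:
  assumes "is_fps_powr c U Y" "fps_nth T 0 = 0"
  shows "is_fps_powr c (U oo T) (Y oo T)"
proof -
  have "(U oo T) * fps_deriv (Y oo T) = ((U * fps_deriv Y) oo T) * fps_deriv T"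
    using assms(2) by (simp add: fps_compose_deriv fps_compose_mult_distrib mult_ac)
  also have "\<dots> = ((fps_const c * fps_deriv U * Y) oo T) * fps_deriv T"
    using assms(1) by (simp add: is_fps_powr_def)
  also have "\<dots> = fps_const c * fps_deriv (U oo T) * (Y oo T)"
    using assms(2) by (simp add: fps_compose_deriv fps_compose_mult_distrib mult_ac)
  finally show ?thesis
    using assms by (simp add: is_fps_powr_def)
qed

lemma is_fps_powr_fps_binomial: "is_fps_powr c (1 + fps_X) (fps_binomial c)"
proof -
  have "(1 + fps_X :: 'a fps) * inverse (1 + fps_X) = 1"
    by (rule inverse_mult_eq_1') simp
  then have "(1 + fps_X) * fps_deriv (fps_binomial c) = fps_const c * fps_binomial c"
    by (simp add: fps_binomial_deriv fps_divide_unit mult_ac)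
  then show ?thesis by (simp add: is_fps_powr_def)
qed

lemma is_fps_powr_pochhammer:
  "is_fps_powr (-c) (1 - fps_const a * fps_X) (Abs_fps (\<lambda>j. pochhammer c j * a ^ j / fact j))"
proof -
  have "fps_binomial (-c) oo (- fps_const a * fps_X) = Abs_fps (\<lambda>j. pochhammer c j * a ^ j / fact j)"
    unfolding fps_const_neg
    by (rule fps_ext) (simp only: fps_nth_compose_linear,
        simp add: gbinomial_pochhammer power_mult_distrib [symmetric] flip: power_mult)
  moreover have "(1 + fps_X) oo (- fps_const a * fps_X) = 1 - fps_const a * fps_X"
    by (simp add: fps_compose_add_distrib)
  ultimately show ?thesis
    using is_fps_powr_compose[OF is_fps_powr_fps_binomial[of "-c"], of "- fps_const a * fps_X"]
    by simp
qed

text \<open>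
  The generating function of the Gegenbauer polynomials: their three-term recurrence is the
  differential equation of \<open>is_fps_powr\<close>, read off coefficientwise.
\<close>
lemma is_fps_powr_gegenbauer:
  assumes "k > 0"
  shows "is_fps_powr (-k) (1 - fps_const (2 * x) * fps_X + fps_X\<^sup>2)
           (Abs_fps (\<lambda>j. poly (gegenbauer_poly k j) x))"
proof -
  define C where "C = Abs_fps (\<lambda>j. poly (gegenbauer_poly k j) x)"
  have C0: "fps_nth C 0 = 1" by (simp add: C_def gegenbauer_poly_def)
  have C1: "fps_nth C (Suc 0) = 2 * k * x"
    using assms by (simp add: C_def poly_gegenbauer_poly field_simps)
  have rec: "real (j + 2) * fps_nth C (j + 2) = 2 * (real j + 1 + k) * x * fps_nth C (j + 1)
               - (real j + 2 * k) * fps_nth C j" for j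
    using gegenbauer_recurrence[OF assms, of j x] by (simp add: C_def)
  have "(1 - fps_const (2 * x) * fps_X + fps_X\<^sup>2) * fps_deriv C =
          fps_deriv C - fps_const (2 * x) * (fps_X * fps_deriv C) + fps_X * (fps_X * fps_deriv C)"
    by (simp add: algebra_simps power2_eq_square)
  also have "\<dots> = fps_const (2 * k * x) * C - fps_const (2 * k) * (fps_X * C)"
  proof (rule fps_ext)
    fix i
    consider "i = 0" | j where "i = Suc j" by (cases i) auto
    then show "fps_nth (fps_deriv C - fps_const (2 * x) * (fps_X * fps_deriv C) +
                  fps_X * (fps_X * fps_deriv C)) i =
               fps_nth (fps_const (2 * k * x) * C - fps_const (2 * k) * (fps_X * C)) i"
    proof cases
      case 1
      then show ?thesis by (simp add: C0 C1)
    next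
      case (2 j)
      have Xd: "fps_nth (fps_X * fps_deriv C) j = real j * fps_nth C j"
        by (cases j) auto
      have "fps_nth (fps_deriv C - fps_const (2 * x) * (fps_X * fps_deriv C) +
                  fps_X * (fps_X * fps_deriv C)) (Suc j) =
              real (j + 2) * fps_nth C (j + 2) - 2 * x * (real (j + 1) * fps_nth C (j + 1)) +
              fps_nth (fps_X * fps_deriv C) j"
        by simp
      also have "\<dots> = 2 * k * x * fps_nth C (j + 1) - 2 * k * fps_nth C j"
        unfolding Xd rec by (simp add: algebra_simps)
      finally show ?thesis by (simp add: 2)
    qed
  qed
  also have "\<dots> = fps_const (-k) * fps_deriv (1 - fps_const (2 * x) * fps_X + fps_X\<^sup>2) * C"
  proof -
    have "fps_deriv (1 - fps_const (2 * x) * fps_X + fps_X\<^sup>2) = 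
            fps_const 2 * fps_X - fps_const (2 * x)"
      by (simp add: fps_deriv_power numeral_fps_const)
    then show ?thesis
      by (simp add: ring_distribs mult.assoc [symmetric]) (simp add: algebra_simps fps_const_neg [symmetric] del: fps_const_neg)
  qed
  finally show ?thesis
    by (simp add: is_fps_powr_def C0 C_def [symmetric])
qed

section \<open>The product over the angles\<close>

lemma prod_one_minus_cis:
  fixes w :: complex
  assumes "n > 0"
  shows "(\<Prod>s=1..n. 1 - cis ((\<xi> + 2 * pi * real s) / real n) * w) = 1 - cis \<xi> * w ^ n"
proof (cases "w = 0")
  case True
  then show ?thesis using assms by simp
next
  case False
  define c where "c = (\<lambda>s. cis ((\<xi> + 2 * pi * real s) / real n))"
  have c_pow: "c s ^ n = cis \<xi>" for s
  proof -
    have "c s ^ n = cis (\<xi> + 2 * pi * real s)"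
      using assms by (simp add: c_def Complex.DeMoivre)
    also have "\<dots> = cis \<xi> * cis (2 * pi * real s)"
      by (simp only: cis_mult)
    also have "cis (2 * pi * real s) = 1"
      by (intro cis_multiple_2pi) auto
    finally show ?thesis by simp
  qed
  have c_Suc: "c (Suc s) = cis ((\<xi> + 2 * pi) / real n) * cis (2 * pi * real s / real n)" for s
    by (simp add: c_def cis_mult add_divide_distrib algebra_simps)
  have "inj_on (\<lambda>s. c (Suc s)) {..<n}"
    using Complex.bij_betw_roots_unity[OF assms] unfolding c_Suc
    by (auto simp: bij_betw_def inj_on_def)
  then have inj: "inj_on c {1..n}"
    using inj_on_imageI[of c Suc "{..<n}"] by (simp add: o_def image_Suc_lessThan)
  \<comment> \<open>The numbers \<open>c s\<close> are \<open>n\<close> distinct roots of \<open>X ^ n - cis \<xi>\<close>, hence all of them. Evaluation of the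
    factorisation at \<open>1 / w\<close> gives the claim.\<close>
  define q where "q = (\<Prod>s=1..n. [:- c s, 1:])"
  have deg: "degree q = n"
    unfolding q_def by (subst degree_prod_eq_sum_degree) auto
  have "lead_coeff q = 1"
    unfolding q_def by (simp add: lead_coeff_prod)
  have "q = monom 1 n - [:cis \<xi>:]"
  proof (rule poly_eqI_degree_lead_coeff[where A = "c ` {1..n}" and n = n])
    show "coeff q n = coeff (monom 1 n - [:cis \<xi>:]) n"
      using \<open>lead_coeff q = 1\<close> deg assms by (simp add: coeff_pCons split: nat.splits)
    show "degree (monom 1 n - [:cis \<xi>:]) \<le> n"
      by (intro degree_diff_le) (auto intro: degree_monom_le)
    fix z assume "z \<in> c ` {1..n}"
    then obtain s where s: "s \<in> {1..n}" "z = c s" by blast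
    then have "poly q z = 0"
      by (auto simp: q_def poly_prod intro!: bexI[of _ s])
    then show "poly q z = poly (monom 1 n - [:cis \<xi>:]) z"
      by (simp add: s c_pow poly_monom)
  qed (use deg inj in \<open>auto simp: card_image\<close>)
  then have "poly q (inverse w) = inverse w ^ n - cis \<xi>"
    by (simp add: poly_monom)
  then have "w ^ n * (\<Prod>s=1..n. inverse w - c s) = 1 - cis \<xi> * w ^ n"
    using False by (simp add: q_def poly_prod field_simps)
  also have "w ^ n * (\<Prod>s=1..n. inverse w - c s) = (\<Prod>s=1..n. w * (inverse w - c s))"
    by (simp add: prod.distrib)
  also have "\<dots> = (\<Prod>s=1..n. 1 - c s * w)"
    using False by (intro prod.cong) (auto simp: field_simps)
  finally show ?thesis by (simp add: c_def)
qed

lemma cmod_one_minus_cis_power2: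
  "(cmod (1 - cis \<theta> * of_real w))\<^sup>2 = 1 - 2 * cos \<theta> * w + w\<^sup>2"
proof -
  have *: "(1 - c * w)\<^sup>2 + (s * w)\<^sup>2 = 1 - 2 * c * w + (s\<^sup>2 + c\<^sup>2) * w\<^sup>2" for c s :: real
    by (simp add: power2_eq_square algebra_simps)
  have "(cmod (1 - cis \<theta> * of_real w))\<^sup>2 = (1 - cos \<theta> * w)\<^sup>2 + (sin \<theta> * w)\<^sup>2"
    by (simp add: cmod_power2)
  also have "\<dots> = 1 - 2 * cos \<theta> * w + ((sin \<theta>)\<^sup>2 + (cos \<theta>)\<^sup>2) * w\<^sup>2"
    by (rule *)
  finally show ?thesis by simp
qed

lemma prod_chebyshev:
  fixes w :: real
  assumes "n > 0"
  shows "(\<Prod>s=1..n. 1 - 2 * cos ((\<xi> + 2 * pi * real s) / real n) * w + w\<^sup>2) =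
           1 - 2 * cos \<xi> * w ^ n + (w ^ n)\<^sup>2"
proof -
  have "(\<Prod>s=1..n. 1 - 2 * cos ((\<xi> + 2 * pi * real s) / real n) * w + w\<^sup>2) =
          (cmod (\<Prod>s=1..n. 1 - cis ((\<xi> + 2 * pi * real s) / real n) * of_real w))\<^sup>2"
    by (simp only: cmod_one_minus_cis_power2 [symmetric] prod_norm [symmetric] prod_power_distrib)
  also have "\<dots> = (cmod (1 - cis \<xi> * of_real (w ^ n)))\<^sup>2"
    by (simp only: prod_one_minus_cis[OF assms] of_real_power)
  finally show ?thesis by (simp only: cmod_one_minus_cis_power2)
qed

lemma fps_prod_chebyshev:
  assumes "n > 0"
  shows "(\<Prod>s=1..n. 1 - fps_const (2 * cos ((\<xi> + 2 * pi * real s) / real n)) * fps_X + fps_X\<^sup>2) =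
           1 - fps_const (2 * cos \<xi>) * fps_X ^ n + (fps_X ^ n)\<^sup>2"
proof -
  let ?b = "\<lambda>s. cos ((\<xi> + 2 * pi * real s) / real n)"
  let ?X = "[:0, 1:] :: real poly"
  have "poly (\<Prod>s=1..n. 1 - [:2 * ?b s:] * ?X + ?X\<^sup>2) w =
          poly (1 - [:2 * cos \<xi>:] * ?X ^ n + (?X ^ n)\<^sup>2) w" for w
  proof -
    have "poly (1 - [:2 * ?b s:] * ?X + ?X\<^sup>2) w = 1 - 2 * ?b s * w + w\<^sup>2" for s
      by simp
    then show ?thesis
      unfolding poly_prod by (simp only: prod_chebyshev[OF assms]) simp
  qed
  then have "(\<Prod>s=1..n. 1 - [:2 * ?b s:] * ?X + ?X\<^sup>2) = 1 - [:2 * cos \<xi>:] * ?X ^ n + (?X ^ n)\<^sup>2"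
    by (intro iffD1[OF poly_eq_poly_eq_iff] ext)
  from arg_cong[OF this, of fps_of_poly] show ?thesis
    by (simp only: fps_of_poly_prod fps_of_poly_add fps_of_poly_diff fps_of_poly_mult
        fps_of_poly_power fps_of_poly_const fps_of_poly_fps_X fps_of_poly_1)
qed

section \<open>Comparison of coefficients\<close>

text \<open>
  The identity \<open>F(w / (1 + w\<^sup>2)) = (\<Sum>\<^sub>j C\<^sub>j(cos \<xi>) w\<^bsup>nj\<^esup>) * (1 + w\<^sup>2) powr (nk)\<close>.
  Multiplied by \<open>(1 + w\<^sup>2) powr (-nk)\<close>, both sides become the \<open>-k\<close>-th power of
  \<open>1 - 2 cos \<xi> w\<^sup>n + w\<^bsup>2n\<^esup>\<close>.
\<close>
lemma compose_prod_eq_gegenbauer: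
  fixes F :: "real fps"
  assumes n: "n > 0" and k: "k > 0"
  assumes F: "is_fps_powr (-k)
      (\<Prod>s=1..n. 1 - fps_const (2 * cos ((\<xi> + 2 * pi * real s) / real n)) * fps_X) F"
  shows "F oo (fps_X * inverse (1 + fps_X\<^sup>2)) =
    (Abs_fps (\<lambda>j. poly (gegenbauer_poly k j) (cos \<xi>)) oo fps_X ^ n) *
    (fps_binomial (real n * k) oo fps_X\<^sup>2)"
proof -
  define \<phi> :: "real fps" where "\<phi> = 1 + fps_X\<^sup>2"
  define T where "T = fps_X * inverse \<phi>"
  define C where "C = Abs_fps (\<lambda>j. poly (gegenbauer_poly k j) (cos \<xi>))"
  define b where "b = (\<lambda>s. cos ((\<xi> + 2 * pi * real s) / real n))"
  define D where "D = fps_binomial (real n * (-k)) oo fps_X\<^sup>2"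
  have T0: "fps_nth T 0 = 0" by (simp add: T_def)
  have inv: "inverse \<phi> * \<phi> = 1" by (rule inverse_mult_eq_1) (simp add: \<phi>_def)
  have "is_fps_powr (-k) ((\<Prod>s=1..n. 1 - fps_const (2 * b s) * fps_X) oo T) (F oo T)"
    by (rule is_fps_powr_compose[OF _ T0]) (use F in \<open>simp add: b_def\<close>)
  moreover have "is_fps_powr (-k) (\<phi> ^ n) D"
  proof (rule is_fps_powr_base_power)
    show "is_fps_powr (real n * - k) \<phi> D"
      using is_fps_powr_compose[OF is_fps_powr_fps_binomial, of "fps_X\<^sup>2" "real n * - k"]
      by (simp add: D_def \<phi>_def fps_compose_add_distrib)
  qed
  ultimately have "is_fps_powr (-k)
      (((\<Prod>s=1..n. 1 - fps_const (2 * b s) * fps_X) oo T) * \<phi> ^ n) ((F oo T) * D)"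
    by (rule is_fps_powr_mult)
  also have "((\<Prod>s=1..n. 1 - fps_const (2 * b s) * fps_X) oo T) * \<phi> ^ n =
               (\<Prod>s=1..n. (1 - fps_const (2 * b s) * T) * \<phi>)"
    using T0 by (simp add: fps_compose_prod_distrib fps_compose_sub_distrib
                  fps_compose_mult_distrib prod.distrib)
  also have "\<dots> = (\<Prod>s=1..n. 1 - fps_const (2 * b s) * fps_X + fps_X\<^sup>2)"
  proof (intro prod.cong refl)
    fix s
    have "(1 - fps_const (2 * b s) * T) * \<phi> = \<phi> - fps_const (2 * b s) * fps_X * (inverse \<phi> * \<phi>)"
      by (simp add: T_def algebra_simps)
    then show "(1 - fps_const (2 * b s) * T) * \<phi> = 1 - fps_const (2 * b s) * fps_X + fps_X\<^sup>2"
      unfolding inv by (simp add: \<phi>_def)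
  qed
  also have "\<dots> = 1 - fps_const (2 * cos \<xi>) * fps_X ^ n + (fps_X ^ n)\<^sup>2"
    using fps_prod_chebyshev[OF n, of \<xi>] by (simp add: b_def)
  also have "\<dots> = (1 - fps_const (2 * cos \<xi>) * fps_X + fps_X\<^sup>2) oo fps_X ^ n"
    using n by (simp add: fps_compose_add_distrib fps_compose_sub_distrib
                  fps_compose_mult_distrib fps_X_power_compose)
  finally have "is_fps_powr (-k)
      ((1 - fps_const (2 * cos \<xi>) * fps_X + fps_X\<^sup>2) oo fps_X ^ n) ((F oo T) * D)" .
  moreover have "is_fps_powr (-k)
      ((1 - fps_const (2 * cos \<xi>) * fps_X + fps_X\<^sup>2) oo fps_X ^ n) (C oo fps_X ^ n)"
    unfolding C_def using n by (intro is_fps_powr_compose is_fps_powr_gegenbauer k) auto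
  ultimately have eq: "(F oo T) * D = C oo fps_X ^ n"
    by (rule is_fps_powr_unique)
  have "D * (fps_binomial (real n * k) oo fps_X\<^sup>2) = 1"
    unfolding D_def
    by (subst fps_compose_mult_distrib [symmetric]) (simp_all flip: fps_binomial_add_mult)
  then have "F oo T = (F oo T) * D * (fps_binomial (real n * k) oo fps_X\<^sup>2)"
    by (simp add: mult.assoc)
  then show ?thesis unfolding eq by (simp add: T_def \<phi>_def C_def)
qed

text \<open>
  For \<open>m > 0\<close> the coefficient is \<open>(c gchoose m) - (c gchoose (m - 1))\<close> with \<open>c = a + p + 2m - 1\<close>.
\<close>
lemma fps_nth_one_minus_X_binomial:
  fixes a p :: real
  assumes a: "a > 0" and p: "p \<ge> 0"
  shows "fps_nth ((1 - fps_X) * fps_binomial (a + p + 2 * real m - 1)) m =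
           (a + p) * Gamma (a + p + 2 * real m) / (fact m * Gamma (a + p + real m + 1))"
proof -
  define c where "c = a + p + 2 * real m - 1"
  have gc: "c gchoose i = Gamma (c + 1) / (fact i * Gamma (c - real i + 1))" for i
    using a p by (intro gbinomial_Gamma) (auto simp: c_def elim!: nonpos_Ints_cases)
  show ?thesis
  proof (cases m)
    case 0
    have "Gamma (a + p + 1) = (a + p) * Gamma (a + p)"
      using a p by (intro Gamma_plus1) (auto elim!: nonpos_Ints_cases)
    moreover have "Gamma (a + p) \<noteq> 0"
      using a p Gamma_real_pos[of "a + p"] by linarith
    ultimately show ?thesis using 0 a p by simp
  next
    case (Suc i)
    define r where "r = a + p + real m"
    have r: "r > 0" using a p by (simp add: r_def add_pos_nonneg)
    have G: "Gamma (r + 1) = r * Gamma r" "Gamma r > 0"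
      using r by (auto intro!: Gamma_plus1 Gamma_real_pos elim!: nonpos_Ints_cases)
    have "fps_nth ((1 - fps_X) * fps_binomial c) m = (c gchoose m) - (c gchoose i)"
      by (simp add: left_diff_distrib Suc)
    also have "\<dots> = Gamma (c + 1) / (fact m * Gamma r) - Gamma (c + 1) / (fact i * Gamma (r + 1))"
      unfolding gc by (simp add: c_def r_def Suc algebra_simps)
    also have "\<dots> = (r - real m) * Gamma (c + 1) / (fact m * Gamma (r + 1))"
    proof -
      have fact_m: "fact m = real m * fact i" and "real m > 0" by (simp_all add: Suc)
      then show ?thesis
        unfolding G(1) fact_m using r G(2) by (simp add: divide_simps) (simp add: algebra_simps)
    qed
    finally show ?thesis by (simp add: c_def r_def algebra_simps)
  qed
qed

theorem proposition1:
  fixes n N :: nat and k \<xi> :: real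
  assumes "n \<ge> 1" and "k > 0" and "0 \<le> \<xi>" and "\<xi> \<le> pi"
  shows
    "(\<Sum>(m, j) \<in> {(m, j). N = 2 * m + n * j}.
        real n * (real j + k) * Gamma (real n * k) /
          (2 ^ (2 * m + n * j) * fact m * Gamma (real n * (real j + k) + real m + 1)) *
        poly (gegenbauer_poly k j) (cos \<xi>)) =
     (\<Sum>J \<in> {J \<in> {1..n} \<rightarrow>\<^sub>E (UNIV :: nat set). (\<Sum>s = 1..n. J s) = N}.
        (\<Prod>s = 1..n. pochhammer k (J s)) / pochhammer (real n * k) N *
        (\<Prod>s = 1..n. cos ((\<xi> + 2 * pi * real s) / real n) ^ J s / fact (J s)))"
proof -
  have n: "n > 0" using assms by simp
  define a where "a = real n * k"
  have a: "a > 0" using assms by (simp add: a_def)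
  define b where "b = (\<lambda>s. cos ((\<xi> + 2 * pi * real s) / real n))"
  \<comment> \<open>The factor 2 makes \<open>X / (1 + X\<^sup>2)\<close>, rather than \<open>2X / (1 + X\<^sup>2)\<close>, the series to be inverted.\<close>
  define f where "f = (\<lambda>s. Abs_fps (\<lambda>j. pochhammer k j * (2 * b s) ^ j / fact j))"
  define F where "F = (\<Prod>s=1..n. f s)"
  define C where "C = Abs_fps (\<lambda>j. poly (gegenbauer_poly k j) (cos \<xi>))"
  define \<phi> :: "real fps" where "\<phi> = 1 + fps_X\<^sup>2"
  have \<phi>0: "fps_nth \<phi> 0 \<noteq> 0" by (simp add: \<phi>_def)
  let ?R = "\<lambda>J. (\<Prod>s=1..n. pochhammer k (J s)) * (\<Prod>s=1..n. b s ^ J s / fact (J s))"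
  let ?S = "{J \<in> {1..n} \<rightarrow>\<^sub>E (UNIV :: nat set). (\<Sum>s = 1..n. J s) = N}"
  let ?M = "{(m, j). N = 2 * m + n * j}"
  have FN: "fps_nth F N = 2 ^ N * (\<Sum>J\<in>?S. ?R J)"
  proof -
    have "fps_nth F N = (\<Sum>J\<in>?S. \<Prod>s=1..n. pochhammer k (J s) * (2 * b s) ^ J s / fact (J s))"
      unfolding F_def by (subst fps_nth_prod_PiE) (auto simp: f_def)
    also have "\<dots> = (\<Sum>J\<in>?S. 2 ^ N * ?R J)"
    proof (intro sum.cong refl)
      fix J assume "J \<in> ?S"
      then have "(\<Prod>s=1..n. (2::real) ^ J s) = 2 ^ N" by (auto simp: power_sum [symmetric])
      then show "(\<Prod>s=1..n. pochhammer k (J s) * (2 * b s) ^ J s / fact (J s)) = 2 ^ N * ?R J"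
        by (simp add: power_mult_distrib prod.distrib prod_dividef)
    qed
    finally show ?thesis by (simp add: sum_distrib_left)
  qed
  have "is_fps_powr (-k) (\<Prod>s=1..n. 1 - fps_const (2 * b s) * fps_X) F"
    unfolding F_def f_def by (intro is_fps_powr_prod is_fps_powr_pochhammer)
  then have comp: "F oo (fps_X * inverse \<phi>) = (C oo fps_X ^ n) * (fps_binomial a oo fps_X\<^sup>2)"
    unfolding \<phi>_def C_def a_def b_def by (intro compose_prod_eq_gegenbauer n assms)
  have X2: "fps_nth (fps_X\<^sup>2 :: real fps) 0 = 0" by simp
  \<comment> \<open>The weight of Lagrange inversion absorbs the factor \<open>(1 + X\<^sup>2) powr a\<close> into the single series
    \<open>(1 - X\<^sup>2) * (1 + X\<^sup>2) powr (a + N - 1)\<close>, a function of \<open>X\<^sup>2\<close>.\<close>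
  have weight: "(fps_binomial a oo fps_X\<^sup>2) * (\<phi> ^ N * (1 - fps_X * fps_deriv \<phi> * inverse \<phi>)) =
                  ((1 - fps_X) * fps_binomial (a + real N - 1)) oo fps_X\<^sup>2"
  proof -
    have pw: "\<phi> ^ N = fps_binomial (real N) oo fps_X\<^sup>2"
      by (simp add: fps_binomial_of_nat \<phi>_def fps_compose_power[OF X2, symmetric]
            fps_compose_add_distrib)
    have iv: "inverse \<phi> = fps_binomial (-1) oo fps_X\<^sup>2"
      by (simp add: fps_binomial_minus_one \<phi>_def fps_inverse_compose fps_compose_add_distrib)
    have inv: "\<phi> * inverse \<phi> = 1" using \<phi>0 by (rule inverse_mult_eq_1')
    have "1 - fps_X * fps_deriv \<phi> * inverse \<phi> = (\<phi> - fps_X * fps_deriv \<phi>) * inverse \<phi>"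
      by (simp add: left_diff_distrib inv)
    also have "\<phi> - fps_X * fps_deriv \<phi> = 1 - fps_X\<^sup>2"
      by (simp add: \<phi>_def fps_deriv_power power2_eq_square)
    also have "\<dots> = (1 - fps_X) oo fps_X\<^sup>2"
      by (simp add: fps_compose_sub_distrib)
    finally have w: "1 - fps_X * fps_deriv \<phi> * inverse \<phi> = 
        ((1 - fps_X) oo fps_X\<^sup>2) * (fps_binomial (-1) oo fps_X\<^sup>2)"
      unfolding iv .
    have "a + real N - 1 = a + (real N + (-1))" by simp
    then have bin: "fps_binomial (a + real N - 1) = 
        fps_binomial a * (fps_binomial (real N) * fps_binomial (-1))"
      by (simp only: fps_binomial_add_mult)
    show ?thesis
      unfolding w pw bin by (simp add: fps_compose_mult_distrib[OF X2] mult_ac)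
  qed
  have "fps_nth F N = fps_nth ((C oo fps_X ^ n) *
          (((1 - fps_X) * fps_binomial (a + real N - 1)) oo fps_X\<^sup>2)) N"
    using fps_lagrange[OF \<phi>0, of F N] unfolding comp mult.assoc[of "C oo _"] weight .
  also have "\<dots> = (\<Sum>(m, j)\<in>?M. fps_nth C j * fps_nth ((1 - fps_X) * fps_binomial (a + real N - 1)) m)"
    using n by (intro fps_nth_mult_compose_X_powers) auto
  also have "\<dots> = (\<Sum>(m, j)\<in>?M. poly (gegenbauer_poly k j) (cos \<xi>) *
      (real n * (real j + k) * Gamma (a + real N) / (fact m * Gamma (real n * (real j + k) + real m + 1))))"
  proof (intro sum.cong refl, clarify)
    fix m j assume N: "N = 2 * m + n * j"
    have "fps_nth ((1 - fps_X) * fps_binomial (a + real N - 1)) m =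
            (a + real (n * j)) * Gamma (a + real N) / (fact m * Gamma (a + real (n * j) + real m + 1))"
      using fps_nth_one_minus_X_binomial[OF a, of "real (n * j)" m] by (simp add: N algebra_simps)
    also have "a + real (n * j) = real n * (real j + k)"
      by (simp add: a_def algebra_simps)
    finally show "fps_nth C j * fps_nth ((1 - fps_X) * fps_binomial (a + real (2 * m + n * j) - 1)) m =
       poly (gegenbauer_poly k j) (cos \<xi>) * (real n * (real j + k) * Gamma (a + real (2 * m + n * j)) /
         (fact m * Gamma (real n * (real j + k) + real m + 1)))"
      unfolding N by (simp add: C_def)
  qed
  finally have main: "2 ^ N * (\<Sum>J\<in>?S. ?R J) = \<dots>" unfolding FN .
  have GN: "Gamma (a + real N) > 0" "Gamma a > 0" using a by (auto intro!: Gamma_real_pos)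
  have poch: "pochhammer a N = Gamma (a + real N) / Gamma a"
    using a by (intro pochhammer_Gamma) (auto elim!: nonpos_Ints_cases)
  have "(\<Sum>J\<in>?S. (\<Prod>s=1..n. pochhammer k (J s)) / pochhammer (real n * k) N *
           (\<Prod>s=1..n. cos ((\<xi> + 2 * pi * real s) / real n) ^ J s / fact (J s))) =
        2 ^ N * (\<Sum>J\<in>?S. ?R J) / (2 ^ N * pochhammer a N)"
    by (simp add: sum_divide_distrib a_def b_def)
  also have "\<dots> = (\<Sum>(m, j)\<in>?M. real n * (real j + k) * Gamma (real n * k) /
          (2 ^ (2 * m + n * j) * fact m * Gamma (real n * (real j + k) + real m + 1)) *
        poly (gegenbauer_poly k j) (cos \<xi>))"
    unfolding main sum_divide_distrib
  proof (intro sum.cong refl, clarify)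
    fix m j assume N: "N = 2 * m + n * j"
    show "poly (gegenbauer_poly k j) (cos \<xi>) * (real n * (real j + k) * Gamma (a + real (2 * m + n * j)) /
         (fact m * Gamma (real n * (real j + k) + real m + 1))) / 
         (2 ^ (2 * m + n * j) * pochhammer a (2 * m + n * j)) =
       real n * (real j + k) * Gamma (real n * k) /
          (2 ^ (2 * m + n * j) * fact m * Gamma (real n * (real j + k) + real m + 1)) *
        poly (gegenbauer_poly k j) (cos \<xi>)"
      using GN unfolding N [symmetric] poch by (simp add: a_def mult_ac)
  qed
  finally show ?thesis by (rule sym)
qed

end
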